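(* Consider the receding horizon planning (RHP) scheme described in the context. Assume that the nominal trajectory $(\bar{\bm x}_{-1}(\cdot),\bar{\bm u}_{-1}(\cdot))$, with terminal time $\bar t_f^{-1}$, is feasible in the full horizon optimal control problem (P). Then, at all RHP iterations $k$ satisfying $t_k+T\le \bar t_f^{k-1}$, there exists a feasible solution to (P).
   Context: **System and full horizon problem (P).** Let $f:\mathbb R^n\times\mathbb R^m\to\mathbb R^n$, $\mathcal X\subseteq\mathbb R^n$, $\mathcal U\subseteq\mathbb R^m$, $\mathcal X_{\rm obst}\subset\mathbb R^n$, $\mathcal X_{\rm free}=\mathcal X\setminus\mathcal X_{\rm obst}$, initial time $t_0$, initial state $\bm x_0\in\mathcal X_{\rm free}$, terminal state $\bm x_f\in\mathcal X_{\rm free}$, and a cost function $\ell:\mathbb R^n\times\mathbb R^m\to\mathbb R$. Problem (P) is: minimize over control trajectories $\bm u(\cdot)$ and terminal times $t_f$ the functional $$J_{\rm tot}(\bm x_0,\bm u(\cdot))=\int_{t_0}^{t_f}\ell(\bm x(t),\bm u(t))\,\mathrm dt$$ subject to $\bm x(t_0)=\bm x_0$, $\bm x(t_f)=\bm x_f$, $\dot{\bm x}(t)=f(\bm x(t),\bm u(t))$, $\bm x(t)\in\mathcal X_{\rm free}$, $\bm u(t)\in\mathcal U$ for $t\in[t_0,t_f]$. A control/state trajectory with its terminal time is feasible in (P) if it satisfies these constraints. **RHP scheme.** A nominal trajectory $(\bar{\bm x}_{-1}(\cdot),\bar{\bm u}_{-1}(\cdot))$ on $[t_0,\bar t_f^{-1}]$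 is given, satisfying $\bar{\bm x}_{-1}(\tau)=\bm x_0+\int_{t_0}^{\tau}f(\bar{\bm x}_{-1}(t),\bar{\bm u}_{-1}(t))\,\mathrm dt$. Fix $\delta>0$ and a horizon length $T\in(\delta,T_{\max}]$, and put $t_k=t_0+k\delta$, $k=0,1,2,\dots$. RHP iterations $k=0,1,2,\dots$ are performed as long as $t_k+T\le\bar t_f^{k-1}$. At iteration $k$, given $(\bar{\bm x}_{k-1},\bar{\bm u}_{k-1},\bar t_f^{k-1})$, define the cost-to-go function $$\Psi_k(\tau)=\int_{\tau}^{\bar t_f^{k-1}}\ell(\bar{\bm x}_{k-1}(t),\bar{\bm u}_{k-1}(t))\,\mathrm dt,\qquad \tau\in[t_0,\bar t_f^{k-1}],$$ and solve the RHP problem: minimize over $\bm u_k(\cdot)$ on $[t_k,t_k+T]$ and $\tau_k\in[t_0,\bar t_f^{k-1}]$ $$J(\bar{\bm x}_{k-1}(t_k),\bm u_k(\cdot),\tau_k)=\Psi_k(\tau_k)+\int_{t_k}^{t_k+T}\ell(\bm x_k(t),\bm u_k(t))\,\mathrm dt$$ subject to $\bm x_k(t_k)=\bar{\bm x}_{k-1}(t_k)$, $\bm x_k(t_k+T)=\bar{\bm x}_{k-1}(\tau_k)$, $\dot{\bm x}_k(t)=f(\bm x_k(t),\bm u_k(t))$, $\bm x_k(t)\in\mathcal X_{\rm free}$, $\bm u_k(t)\in\mathcal U$ for $t\in[t_k,t_k+T]$. Let $(\bm u_k^\star(\cdot),\tau_k^\star)$ be an optimal solution of this RHP problem (assumed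 to exist), and set $\Delta t_k=\tau_k^\star-(t_k+T)$, $\bar t_f^{k}=\bar t_f^{k-1}-\Delta t_k$, and $$\bar{\bm u}_k(t)=\begin{cases}\bar{\bm u}_{k-1}(t), & t\in[t_0,t_k),\\ \bm u_k^\star(t), & t\in[t_k,t_k+T),\\ \bar{\bm u}_{k-1}(t+\Delta t_k), & t\in[t_k+T,\bar t_f^{k-1}-\Delta t_k],\end{cases}$$ with $\bar{\bm x}_k(\cdot)$ defined analogously (using the optimal state trajectory $\bm x_k^\star$ on $[t_k,t_k+T)$). *)

theory Defs
  imports "HOL-Analysis.Analysis"
begin

record ('n, 'm) ocp =
  dyn :: "real ^ 'n \<Rightarrow> real ^ 'm \<Rightarrow> real ^ 'n"
  cost :: "real ^ 'n \<Rightarrow> real ^ 'm \<Rightarrow> real"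
  states :: "(real ^ 'n) set"
  obstacles :: "(real ^ 'n) set"
  controls :: "(real ^ 'm) set"
  t_init :: real
  x_init :: "real ^ 'n"
  x_final :: "real ^ 'n"

definition free :: "('n::finite, 'm::finite) ocp \<Rightarrow> (real ^ 'n) set" where
  "free P = states P - obstacles P"

text \<open>
  Trajectories are total functions on the reals of which only the values on the relevant interval
  matter. Since controls are spliced and hence may jump, the differential equation
  \<open>x' = f (x, u)\<close> is understood in the sense of Caratheodory, that is, as the integral equation;
  \<open>absolutely_integrable_on\<close> is Lebesgue integrability, for which \<open>integral\<close> is the Lebesgue integral.
\<close>

definition solves_ode ::
  "('n::finite, 'm::finite) ocp \<Rightarrow> (real \<Rightarrow> real ^ 'n) \<Rightarrow> (real \<Rightarrow> real ^ 'm) \<Rightarrow> real \<Rightarrow> real \<Rightarrow> bool" where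
  "solves_ode P x u a b \<longleftrightarrow>
     (\<lambda>t. dyn P (x t) (u t)) absolutely_integrable_on {a..b} \<and>
     (\<forall>\<tau>\<in>{a..b}. x \<tau> = x a + integral {a..\<tau>} (\<lambda>t. dyn P (x t) (u t)))"

definition admissible ::
  "('n::finite, 'm::finite) ocp \<Rightarrow> (real \<Rightarrow> real ^ 'n) \<Rightarrow> (real \<Rightarrow> real ^ 'm) \<Rightarrow> real \<Rightarrow> real \<Rightarrow> bool" where
  "admissible P x u a b \<longleftrightarrow>
     a \<le> b \<and> solves_ode P x u a b \<and> (\<forall>t\<in>{a..b}. x t \<in> free P \<and> u t \<in> controls P)"

definition feasible ::
  "('n::finite, 'm::finite) ocp \<Rightarrow> (real \<Rightarrow> real ^ 'n) \<Rightarrow> (real \<Rightarrow> real ^ 'm) \<Rightarrow> real \<Rightarrow> bool" where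
  "feasible P x u tf \<longleftrightarrow>
     admissible P x u (t_init P) tf \<and> x (t_init P) = x_init P \<and> x tf = x_final P"

definition cost_defined ::
  "('n::finite, 'm::finite) ocp \<Rightarrow> (real \<Rightarrow> real ^ 'n) \<Rightarrow> (real \<Rightarrow> real ^ 'm) \<Rightarrow> real \<Rightarrow> real \<Rightarrow> bool" where
  "cost_defined P x u a b \<longleftrightarrow> (\<lambda>t. cost P (x t) (u t)) absolutely_integrable_on {a..b}"

definition running_cost ::
  "('n::finite, 'm::finite) ocp \<Rightarrow> (real \<Rightarrow> real ^ 'n) \<Rightarrow> (real \<Rightarrow> real ^ 'm) \<Rightarrow> real \<Rightarrow> real \<Rightarrow> real" where
  "running_cost P x u a b = integral {a..b} (\<lambda>t. cost P (x t) (u t))"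

text \<open>
  The receding horizon problem on \<open>[s, s + T]\<close> relative to a previous trajectory \<open>(xp, up)\<close>
  with terminal time \<open>tfp\<close>.
\<close>

definition rhp_feasible ::
  "('n::finite, 'm::finite) ocp \<Rightarrow> real \<Rightarrow> real \<Rightarrow> (real \<Rightarrow> real ^ 'n) \<Rightarrow> real \<Rightarrow>
   (real \<Rightarrow> real ^ 'n) \<Rightarrow> (real \<Rightarrow> real ^ 'm) \<Rightarrow> real \<Rightarrow> bool" where
  "rhp_feasible P s T xp tfp x u \<tau> \<longleftrightarrow>
     \<tau> \<in> {t_init P..tfp} \<and> admissible P x u s (s + T) \<and> x s = xp s \<and> x (s + T) = xp \<tau>"

definition rhp_cost_defined ::
  "('n::finite, 'm::finite) ocp \<Rightarrow> real \<Rightarrow> real \<Rightarrow> (real \<Rightarrow> real ^ 'n) \<Rightarrow> (real \<Rightarrow> real ^ 'm) \<Rightarrow> real \<Rightarrow>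
   (real \<Rightarrow> real ^ 'n) \<Rightarrow> (real \<Rightarrow> real ^ 'm) \<Rightarrow> real \<Rightarrow> bool" where
  "rhp_cost_defined P s T xp up tfp x u \<tau> \<longleftrightarrow>
     cost_defined P xp up \<tau> tfp \<and> cost_defined P x u s (s + T)"

definition rhp_cost ::
  "('n::finite, 'm::finite) ocp \<Rightarrow> real \<Rightarrow> real \<Rightarrow> (real \<Rightarrow> real ^ 'n) \<Rightarrow> (real \<Rightarrow> real ^ 'm) \<Rightarrow> real \<Rightarrow>
   (real \<Rightarrow> real ^ 'n) \<Rightarrow> (real \<Rightarrow> real ^ 'm) \<Rightarrow> real \<Rightarrow> real" where
  "rhp_cost P s T xp up tfp x u \<tau> = running_cost P xp up \<tau> tfp + running_cost P x u s (s + T)"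

text \<open>
  The integral of a non-integrable function is 0 by convention, so the minimization ranges over
  those feasible candidates whose cost integrals exist.
\<close>

definition rhp_optimal ::
  "('n::finite, 'm::finite) ocp \<Rightarrow> real \<Rightarrow> real \<Rightarrow> (real \<Rightarrow> real ^ 'n) \<Rightarrow> (real \<Rightarrow> real ^ 'm) \<Rightarrow> real \<Rightarrow>
   (real \<Rightarrow> real ^ 'n) \<Rightarrow> (real \<Rightarrow> real ^ 'm) \<Rightarrow> real \<Rightarrow> bool" where
  "rhp_optimal P s T xp up tfp x u \<tau> \<longleftrightarrow>
     rhp_feasible P s T xp tfp x u \<tau> \<and> rhp_cost_defined P s T xp up tfp x u \<tau> \<and>
     (\<forall>x' u' \<tau>'. rhp_feasible P s T xp tfp x' u' \<tau>' \<and> rhp_cost_defined P s T xp up tfp x' u' \<tau>' \<longrightarrow>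
        rhp_cost P s T xp up tfp x u \<tau> \<le> rhp_cost P s T xp up tfp x' u' \<tau>')"

record ('n, 'm) rhp_run =
  stride :: real
  horizon :: real
  nom_x :: "real \<Rightarrow> real ^ 'n"
  nom_u :: "real \<Rightarrow> real ^ 'm"
  nom_tf :: real
  opt_x :: "nat \<Rightarrow> real \<Rightarrow> real ^ 'n"
  opt_u :: "nat \<Rightarrow> real \<Rightarrow> real ^ 'm"
  opt_tau :: "nat \<Rightarrow> real"

definition rhp_time :: "('n::finite, 'm::finite) ocp \<Rightarrow> ('n, 'm) rhp_run \<Rightarrow> nat \<Rightarrow> real" where
  "rhp_time P R k = t_init P + real k * stride R"

definition rhp_shift :: "('n::finite, 'm::finite) ocp \<Rightarrow> ('n, 'm) rhp_run \<Rightarrow> nat \<Rightarrow> real" where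
  "rhp_shift P R k = opt_tau R k - (rhp_time P R k + horizon R)"

definition splice :: "real \<Rightarrow> real \<Rightarrow> real \<Rightarrow> (real \<Rightarrow> 'a) \<Rightarrow> (real \<Rightarrow> 'a) \<Rightarrow> real \<Rightarrow> 'a" where
  "splice s T \<Delta> old new t =
     (if t < s then old t else if t < s + T then new t else old (t + \<Delta>))"

text \<open>
  The sequences below are indexed by the iteration that uses them: the value at \<open>k\<close> is the
  trajectory (terminal time) with index \<open>k - 1\<close> that enters iteration \<open>k\<close>, so 0 gives the
  nominal trajectory and \<open>Suc k\<close> gives the outcome of iteration \<open>k\<close>. They are total; values beyond
  the last iteration performed carry no meaning.
\<close>

primrec tf_bar :: "('n::finite, 'm::finite) ocp \<Rightarrow> ('n, 'm) rhp_run \<Rightarrow> nat \<Rightarrow> real" where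
  "tf_bar P R 0 = nom_tf R"
| "tf_bar P R (Suc k) = tf_bar P R k - rhp_shift P R k"

primrec x_bar :: "('n::finite, 'm::finite) ocp \<Rightarrow> ('n, 'm) rhp_run \<Rightarrow> nat \<Rightarrow> real \<Rightarrow> real ^ 'n" where
  "x_bar P R 0 = nom_x R"
| "x_bar P R (Suc k) =
     splice (rhp_time P R k) (horizon R) (rhp_shift P R k) (x_bar P R k) (opt_x R k)"

primrec u_bar :: "('n::finite, 'm::finite) ocp \<Rightarrow> ('n, 'm) rhp_run \<Rightarrow> nat \<Rightarrow> real \<Rightarrow> real ^ 'm" where
  "u_bar P R 0 = nom_u R"
| "u_bar P R (Suc k) =
     splice (rhp_time P R k) (horizon R) (rhp_shift P R k) (u_bar P R k) (opt_u R k)"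

definition rhp_performed :: "('n::finite, 'm::finite) ocp \<Rightarrow> ('n, 'm) rhp_run \<Rightarrow> nat \<Rightarrow> bool" where
  "rhp_performed P R k \<longleftrightarrow> (\<forall>j\<le>k. rhp_time P R j + horizon R \<le> tf_bar P R j)"

definition rhp_solves :: "('n::finite, 'm::finite) ocp \<Rightarrow> ('n, 'm) rhp_run \<Rightarrow> nat \<Rightarrow> bool" where
  "rhp_solves P R k \<longleftrightarrow>
     rhp_optimal P (rhp_time P R k) (horizon R) (x_bar P R k) (u_bar P R k) (tf_bar P R k)
       (opt_x R k) (opt_u R k) (opt_tau R k)"

end

theory Submission
  imports Defs
begin

text \<open>Feasibility is an invariant of the iteration. The updated trajectory consists of three
  pieces: the old one up to \<open>s\<close>, the RHP solution on \<open>[s, s + T]\<close>, and the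
  old one from \<open>\<tau>\<close> on, moved in time by
  \<open>\<Delta> = \<tau> - (s + T)\<close>. Each piece is admissible, the last because neither the
  dynamics nor the constraints depend on time. The RHP boundary conditions make the states match at
  both junctions, so the pieces concatenate into a solution of the integral equation with the old
  endpoints. \<open>admissible_translate\<close> and \<open>admissible_append\<close> supply
  shifting and gluing, \<open>feasible_splice\<close> is one iteration, and induction from the
  nominal trajectory finishes the proof.\<close>

lemma solves_ode_absolutely_integrable:
  "solves_ode P x u a b \<Longrightarrow> (\<lambda>t. dyn P (x t) (u t)) absolutely_integrable_on {a..b}"
  by (simp add: solves_ode_def)

lemma solves_odeD:
  "\<lbrakk>solves_ode P x u a b; a \<le> \<tau>; \<tau> \<le> b\<rbrakk> \<Longrightarrow>
     x \<tau> = x a + integral {a..\<tau>} (\<lambda>t. dyn P (x t) (u t))"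
  unfolding solves_ode_def by (meson atLeastAtMost_iff)

lemma solves_odeI:
  assumes "(\<lambda>t. dyn P (x t) (u t)) absolutely_integrable_on {a..b}"
    and "\<And>\<tau>. \<lbrakk>a \<le> \<tau>; \<tau> \<le> b\<rbrakk> \<Longrightarrow> x \<tau> = x a + integral {a..\<tau>} (\<lambda>t. dyn P (x t) (u t))"
  shows "solves_ode P x u a b"
  unfolding solves_ode_def using assms by (meson atLeastAtMost_iff)

text \<open>The integral equations at \<open>c\<close> and at \<open>\<tau>\<close>, both based at
  \<open>a\<close>, are subtracted.\<close>

lemma solves_ode_subinterval:
  assumes ode: "solves_ode P x u a b" and "a \<le> c" "c \<le> d" "d \<le> b"
  shows "solves_ode P x u c d"
proof (rule solves_odeI)
  let ?f = "\<lambda>t. dyn P (x t) (u t)"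
  have sub: "?f absolutely_integrable_on {c'..d'}" if "a \<le> c'" "d' \<le> b" for c' d'
    using solves_ode_absolutely_integrable[OF ode]
    by (rule absolutely_integrable_on_subinterval) (use that in auto)
  show "?f absolutely_integrable_on {c..d}"
    using assms(2,4) by (rule sub)
  fix \<tau> assume \<tau>: "c \<le> \<tau>" "\<tau> \<le> d"
  have "?f integrable_on {a..\<tau>}"
    using sub[of a \<tau>] \<tau> \<open>d \<le> b\<close> by (simp add: absolutely_integrable_on_def)
  then have split: "integral {a..c} ?f + integral {c..\<tau>} ?f = integral {a..\<tau>} ?f"
    by (intro Henstock_Kurzweil_Integration.integral_combine \<open>a \<le> c\<close> \<open>c \<le> \<tau>\<close>)
  have "x \<tau> = x a + integral {a..\<tau>} ?f"
    using ode by (rule solves_odeD) (use \<tau> assms(2-4) in auto)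
  moreover have "x c = x a + integral {a..c} ?f"
    using ode by (rule solves_odeD) (use assms(2-4) in auto)
  ultimately show "x \<tau> = x c + integral {c..\<tau>} ?f"
    unfolding split[symmetric] by (simp only: add.assoc)
qed

text \<open>The control enters only under the integral, so it may change on a null set; the state is
  constrained pointwise and must agree everywhere. This absorbs the jump of a spliced control at a
  junction.\<close>

lemma solves_ode_spike:
  assumes ode: "solves_ode P x u a b" and "negligible S"
    and z: "\<And>t. t \<in> {a..b} \<Longrightarrow> z t = x t" and w: "\<And>t. t \<in> {a..b} - S \<Longrightarrow> w t = u t"
  shows "solves_ode P z w a b"
proof (rule solves_odeI)
  show "(\<lambda>t. dyn P (z t) (w t)) absolutely_integrable_on {a..b}"
    using solves_ode_absolutely_integrable[OF ode] \<open>negligible S\<close>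
    by (rule absolutely_integrable_spike) (use z w in auto)
  fix \<tau> assume \<tau>: "a \<le> \<tau>" "\<tau> \<le> b"
  have "integral {a..\<tau>} (\<lambda>t. dyn P (x t) (u t)) = integral {a..\<tau>} (\<lambda>t. dyn P (z t) (w t))"
    using \<open>negligible S\<close> by (rule integral_spike) (use \<tau> z w in auto)
  moreover have "z \<tau> = x \<tau>" "z a = x a"
    using z \<tau> by auto
  ultimately show "z \<tau> = z a + integral {a..\<tau>} (\<lambda>t. dyn P (z t) (w t))"
    using solves_odeD[OF ode \<tau>] by metis
qed

lemma solves_ode_combine:
  assumes ab: "solves_ode P x u a b" and bc: "solves_ode P x u b c" and "a \<le> b" "b \<le> c"
  shows "solves_ode P x u a c"
proof (rule solves_odeI)
  let ?f = "\<lambda>t. dyn P (x t) (u t)"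
  show abs_int: "?f absolutely_integrable_on {a..c}"
    using ab bc \<open>a \<le> b\<close> \<open>b \<le> c\<close>
    by (rule absolutely_integrable_on_combine[OF solves_ode_absolutely_integrable
          solves_ode_absolutely_integrable])
  fix \<tau> assume \<tau>: "a \<le> \<tau>" "\<tau> \<le> c"
  show "x \<tau> = x a + integral {a..\<tau>} ?f"
  proof (cases "\<tau> \<le> b")
    case True
    with ab \<open>a \<le> \<tau>\<close> show ?thesis by (rule solves_odeD)
  next
    case False
    then have "b \<le> \<tau>" by simp
    have "?f absolutely_integrable_on {a..\<tau>}"
      using abs_int by (rule absolutely_integrable_on_subinterval) (use \<tau> in auto)
    then have "?f integrable_on {a..\<tau>}"
      by (simp add: absolutely_integrable_on_def)
    then have split: "integral {a..b} ?f + integral {b..\<tau>} ?f = integral {a..\<tau>} ?f"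
      by (intro Henstock_Kurzweil_Integration.integral_combine \<open>a \<le> b\<close> \<open>b \<le> \<tau>\<close>)
    have "x b = x a + integral {a..b} ?f"
      using ab \<open>a \<le> b\<close> order_refl by (rule solves_odeD)
    moreover have "x \<tau> = x b + integral {b..\<tau>} ?f"
      using bc \<open>b \<le> \<tau>\<close> \<open>\<tau> \<le> c\<close> by (rule solves_odeD)
    ultimately show ?thesis
      unfolding split[symmetric] by (simp only: add.assoc)
  qed
qed

text \<open>Substitution in the integral; it works because \<open>dyn\<close> has no explicit time
  argument.\<close>

lemma solves_ode_translate:
  assumes "solves_ode P x u (a + c) (b + c)"
  shows "solves_ode P (\<lambda>t. x (t + c)) (\<lambda>t. u (t + c)) a b"
proof (rule solves_odeI)
  let ?f = "\<lambda>t. dyn P (x t) (u t)"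
  \<comment> \<open>Absolute integrability is integrability of \<open>?f\<close> and of its norm,
    and each is shifted separately.\<close>
  show "(\<lambda>t. ?f (t + c)) absolutely_integrable_on {a..b}"
    using solves_ode_absolutely_integrable[OF assms]
      integrable_shift_real_ivl[of ?f "a + c" "b + c" c]
      integrable_shift_real_ivl[of "\<lambda>t. norm (?f t)" "a + c" "b + c" c]
    by (simp add: absolutely_integrable_on_def)
  fix \<tau> assume \<tau>: "a \<le> \<tau>" "\<tau> \<le> b"
  have "integral {a..\<tau>} (\<lambda>t. ?f (t + c)) = integral {a + c..\<tau> + c} ?f"
    using integral_shift_real_ivl[of "a + c" c "\<tau> + c" ?f] by simp
  moreover have "x (\<tau> + c) = x (a + c) + integral {a + c..\<tau> + c} ?f"
    using assms by (rule solves_odeD) (use \<tau> in auto)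
  ultimately show "x (\<tau> + c) = x (a + c) + integral {a..\<tau>} (\<lambda>t. ?f (t + c))"
    by metis
qed

lemma admissible_subinterval:
  assumes "admissible P x u a b" "a \<le> c" "c \<le> d" "d \<le> b"
  shows "admissible P x u c d"
  using assms solves_ode_subinterval[of P x u a b c d] by (auto simp: admissible_def)

lemma admissible_translate:
  assumes "admissible P x u (a + c) (b + c)"
  shows "admissible P (\<lambda>t. x (t + c)) (\<lambda>t. u (t + c)) a b"
  using assms solves_ode_translate[of P x u a c b] by (auto simp: admissible_def)

text \<open>At \<open>b\<close> the glued functions take the values of the second piece. On
  \<open>{a..b}\<close> this leaves the state unchanged, as \<open>x b = y b\<close>, and alters the
  control at most on the null set \<open>{b}\<close>.\<close>

lemma admissible_append:
  assumes ab: "admissible P x u a b" and bc: "admissible P y v b c" and "x b = y b"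
  shows "admissible P (\<lambda>t. if t < b then x t else y t) (\<lambda>t. if t < b then u t else v t) a c"
proof -
  let ?z = "\<lambda>t. if t < b then x t else y t" and ?w = "\<lambda>t. if t < b then u t else v t"
  have "solves_ode P ?z ?w a b"
  proof (rule solves_ode_spike)
    show "solves_ode P x u a b" using ab by (simp add: admissible_def)
    show "negligible {b}" by simp
  qed (use \<open>x b = y b\<close> in auto)
  moreover have "solves_ode P ?z ?w b c"
  proof (rule solves_ode_spike)
    show "solves_ode P y v b c" using bc by (simp add: admissible_def)
    show "negligible {}" by simp
  qed auto
  ultimately have "solves_ode P ?z ?w a c"
    using ab bc by (auto simp: admissible_def intro: solves_ode_combine)
  with ab bc show ?thesis by (auto simp: admissible_def)
qed

text \<open>One RHP iteration. Here \<open>\<tau>\<close> may be any time in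
  \<open>{t_init P..tf}\<close>, even before \<open>s\<close>: the old trajectory is then partly
  repeated and \<open>\<Delta>\<close> is negative.\<close>

lemma feasible_splice:
  assumes old: "feasible P x u tf" and new: "rhp_feasible P s T x tf y v \<tau>"
    and "t_init P \<le> s" "s \<le> tf" "0 < T"
  defines "\<Delta> \<equiv> \<tau> - (s + T)"
  shows "feasible P (splice s T \<Delta> x y) (splice s T \<Delta> u v) (tf - \<Delta>)"
proof -
  have adm_old: "admissible P x u (t_init P) tf" and "x (t_init P) = x_init P" "x tf = x_final P"
    using old by (auto simp: feasible_def)
  have \<tau>: "t_init P \<le> \<tau>" "\<tau> \<le> tf" and adm_new: "admissible P y v s (s + T)"
    and joint: "y s = x s" "y (s + T) = x \<tau>"
    using new by (auto simp: rhp_feasible_def)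
  have shift: "s + T + \<Delta> = \<tau>" by (simp add: \<Delta>_def)
  \<comment> \<open>This is the old trajectory on \<open>[\<tau>, tf]\<close>, with endpoints
    written in the form that \<open>admissible_translate\<close> expects.\<close>
  have "admissible P x u (s + T + \<Delta>) (tf - \<Delta> + \<Delta>)"
    using admissible_subinterval[OF adm_old] \<tau> shift by simp
  then have "admissible P (\<lambda>t. x (t + \<Delta>)) (\<lambda>t. u (t + \<Delta>)) (s + T) (tf - \<Delta>)"
    by (rule admissible_translate)
  from admissible_append[OF adm_new this]
  have tail: "admissible P (\<lambda>t. if t < s + T then y t else x (t + \<Delta>))
      (\<lambda>t. if t < s + T then v t else u (t + \<Delta>)) s (tf - \<Delta>)"
    using joint shift by simp
  have head: "admissible P x u (t_init P) s"
    using admissible_subinterval[OF adm_old] assms(3,4) by simp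
  \<comment> \<open>Since \<open>0 < T\<close>, the tail starts with the value
    \<open>y s = x s\<close>, so it can be appended to the head; the nested conditionals are exactly
    \<open>splice\<close>.\<close>
  have "admissible P (splice s T \<Delta> x y) (splice s T \<Delta> u v) (t_init P) (tf - \<Delta>)"
    using admissible_append[OF head tail] joint \<open>0 < T\<close> by (simp add: splice_def [abs_def])
  \<comment> \<open>If \<open>s = t_init P\<close>, as in iteration 0, the new piece is already
    active here, and \<open>y s = x s\<close> gives the value.\<close>
  moreover have "splice s T \<Delta> x y (t_init P) = x_init P"
    using \<open>x (t_init P) = x_init P\<close> joint \<open>t_init P \<le> s\<close> \<open>0 < T\<close> by (auto simp: splice_def)
  \<comment> \<open>As \<open>tf - \<Delta> = s + T + (tf - \<tau>)\<close> is at least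
    \<open>s + T\<close>, the shifted branch applies, also when \<open>\<tau> = tf\<close>.\<close>
  moreover have "splice s T \<Delta> x y (tf - \<Delta>) = x_final P"
    using \<open>x tf = x_final P\<close> \<tau> \<open>0 < T\<close> by (simp add: splice_def \<Delta>_def)
  ultimately show ?thesis by (simp add: feasible_def)
qed

theorem lemma1:
  fixes P :: "('n::finite, 'm::finite) ocp"
    and R :: "('n, 'm) rhp_run"
    and T_max :: real
    and k :: nat
  assumes "x_init P \<in> free P" and "x_final P \<in> free P"
    and "0 < stride R" and "stride R < horizon R" and "horizon R \<le> T_max"
    and optimal: "\<And>j. rhp_performed P R j \<Longrightarrow> rhp_solves P R j"
    and nominal: "feasible P (nom_x R) (nom_u R) (nom_tf R)"
    and "rhp_performed P R k"
  shows "feasible P (x_bar P R (Suc k)) (u_bar P R (Suc k)) (tf_bar P R (Suc k))"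
proof -
  have step: "feasible P (x_bar P R (Suc j)) (u_bar P R (Suc j)) (tf_bar P R (Suc j))"
    if "feasible P (x_bar P R j) (u_bar P R j) (tf_bar P R j)" "rhp_performed P R j" for j
  proof -
    have "rhp_feasible P (rhp_time P R j) (horizon R) (x_bar P R j) (tf_bar P R j)
        (opt_x R j) (opt_u R j) (opt_tau R j)"
      using optimal[OF that(2)] by (simp add: rhp_solves_def rhp_optimal_def)
    moreover have "t_init P \<le> rhp_time P R j"
      using \<open>0 < stride R\<close> by (simp add: rhp_time_def)
    moreover have "rhp_time P R j + horizon R \<le> tf_bar P R j"
      using that(2) by (simp add: rhp_performed_def)
    ultimately show ?thesis
      using feasible_splice[OF that(1)] \<open>0 < stride R\<close> \<open>stride R < horizon R\<close>
      by (simp add: rhp_shift_def)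
  qed
  show ?thesis
    using \<open>rhp_performed P R k\<close>
  \<comment> \<open>The claim at \<open>k\<close> concerns the outcome of iteration
    \<open>k\<close>, so the base case already takes one step from the nominal trajectory. That
    \<open>rhp_performed\<close> covers all earlier iterations makes the induction hypothesis
    available.\<close>
  proof (induction k)
    case 0
    then show ?case using step[of 0] nominal by simp
  next
    case (Suc k)
    then have "rhp_performed P R k" by (simp add: rhp_performed_def)
    with Suc show ?case using step by blast
  qed
qed

end
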